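(* Let $X$ be a discrete random loss with $\mathbb{P}(X=x_k)=p_k$, $k=1,\dots,K$, where $x_1<x_2<\cdots<x_K$. Then the distributionally robust averaged random spectral risk measure of $X$ under the Kantorovich ambiguity set $\mathfrak{Q}_K^V(Q_V,r)$, $$\sup_{Q\in\mathfrak{Q}_K^V(Q_V,r)}\mathbb{E}_Q\left[\int_0^1 F_X^{\leftarrow}(t)\,\sigma(t,s)\,dt\right],$$ equals the optimal value of the linear programming problem $$\begin{aligned}\sup_{\boldsymbol{q},\boldsymbol{w}}\quad &\sum_{i=1}^V q_i\sum_{k=1}^K x_k\psi_{i,k}\\ \text{s.t.}\quad &\sum_{j=1}^V w_{ij}=q_i,\quad \sum_{i=1}^V w_{ij}=\frac{N_j}{N},\quad \forall\, i,j\in\{1,\dots,V\},\\ &\sum_{i=1}^V\sum_{j=1}^V w_{ij}|\hat{s}^i-\hat{s}^j|\le r,\quad \sum_{i=1}^V q_i=1,\\ & w_{ij}\ge 0,\ q_i\ge 0,\quad\forall\, i,j\in\{1,\dots,V\},\end{aligned}$$ where $\psi_{i,k}=\int_{\pi_k}^{\pi_{k+1}}\sigma(t,\hat{s}^i)\,dt$ for $i=1,\dots,V$, $k=1,\dots,K$, and $\pi_k=\sum_{i=1}^{k-1}p_i$ (so $\pi_1=0$, $\pi_{K+1}=1$).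
   Context: $F_X^{\leftarrow}$ denotes the (left-continuous) quantile function of $X$. $S$ is the support set of a random state variable $s$, contained in a Euclidean space with norm $|\cdot|$. For each $s\in S$, $\sigma(\cdot,s):[0,1)\to\mathbb{R}_+$ is a risk spectrum, i.e. a non-negative, non-decreasing, right-continuous function with $\int_0^1\sigma(t,s)\,dt=1$; the random spectral risk measure is $\rho_{\sigma(\cdot,s)}(X)=\int_0^1F_X^{\leftarrow}(t)\sigma(t,s)\,dt$. Let $\mathcal{S}^V=\{\hat{s}^1,\dots,\hat{s}^V\}\subset S$ be a pre-selected set of points, and let $\{S_1,\dots,S_V\}$ be a Voronoi tessellation of $S$ centered at $\mathcal{S}^V$, i.e. pairwise disjoint sets forming a partition of $S$ with $S_j\subseteq\{s\in S:|s-\hat{s}^j|=\min_{k}|s-\hat{s}^k|\}$. Given a sample $s^1,\dots,s^N$ of $s$, $N_j$ is the number of sample points falling in $S_j$, and $Q_V=\sum_{j=1}^V\frac{N_j}{N}\delta_{\hat{s}^j}$, where $\delta_{\hat s^j}$ is the Dirac measure at $\hat s^j$. $\mathscr{P}(\mathcal{S}^V)$ is the set of probability distributions supported on $\mathcal{S}^V$. For $r>0$, $\mathfrak{Q}_K^V(Q_V,r)=\{Q\in\mathscr{P}(\mathcal{S}^V):\mathsf{dl}_K(Q,Q_V)\le r\}$, where $\mathsf{dl}_K(Q_1,Q_2)=\inf_\Pi\int_{S\times S}|s_1-s_2|\,\Pi(ds_1\times ds_2)$ is the Kantorovich metric, the infimum being over joint distributions $\Pi$ on $S\times S$ with marginals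 $Q_1$ and $Q_2$. *)

theory Defs
  imports "HOL-Probability.Probability"
begin

definition dist_support :: "'a::topological_space measure \<Rightarrow> 'a set" where
  "dist_support \<mu> = {x. \<forall>U. open U \<longrightarrow> x \<in> U \<longrightarrow> emeasure \<mu> U > 0}"

(* Left-continuous generalized inverse of the distribution function of X; only its values on
   the open interval (0,1) are meaningful. *)
definition quantile :: "'m measure \<Rightarrow> ('m \<Rightarrow> real) \<Rightarrow> real \<Rightarrow> real" where
  "quantile M X t = Inf {x. t \<le> cdf (distr M borel X) x}"

(* The library's LBINT over t=0..1 integrates over the open interval (0,1), so the values of f
   outside [0,1) play no role. *)
definition risk_spectrum :: "(real \<Rightarrow> real) \<Rightarrow> bool" where
  "risk_spectrum f \<longleftrightarrow>
     (\<forall>t\<in>{0..<1}. 0 \<le> f t) \<and> mono_on {0..<1} f \<and>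
     (\<forall>t\<in>{0..<1}. continuous (at_right t) f) \<and>
     interval_lebesgue_integrable lborel 0 1 f \<and> (LBINT t=0..1. f t) = 1"

definition spectral_risk :: "'m measure \<Rightarrow> ('m \<Rightarrow> real) \<Rightarrow> (real \<Rightarrow> real) \<Rightarrow> real" where
  "spectral_risk M X f = (LBINT t=0..1. quantile M X t * f t)"

definition voronoi_tessellation ::
  "'s::real_normed_vector set \<Rightarrow> nat \<Rightarrow> (nat \<Rightarrow> 's) \<Rightarrow> (nat \<Rightarrow> 's set) \<Rightarrow> bool" where
  "voronoi_tessellation S V c C \<longleftrightarrow>
     (\<Union>j\<in>{1..V}. C j) = S \<and> disjoint_family_on C {1..V} \<and>
     (\<forall>j\<in>{1..V}. C j \<subseteq> {s\<in>S. norm (s - c j) = Min ((\<lambda>k. norm (s - c k)) ` {1..V})})"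

(* N_j / N *)
definition cell_freq :: "nat \<Rightarrow> (nat \<Rightarrow> 's) \<Rightarrow> (nat \<Rightarrow> 's set) \<Rightarrow> nat \<Rightarrow> real" where
  "cell_freq N smp C j = real (card {n\<in>{1..N}. smp n \<in> C j}) / real N"

(* The mixture of the Dirac measures at c 1, ..., c V with weights a 1, ..., a V.
   embed_pmf is only specified for non-negative functions of total mass 1; see pmf_dirac_mixture. *)
definition dirac_mixture :: "nat \<Rightarrow> (nat \<Rightarrow> 's) \<Rightarrow> (nat \<Rightarrow> real) \<Rightarrow> 's pmf" where
  "dirac_mixture V c a = embed_pmf (\<lambda>x. \<Sum>j=1..V. a j * pmf (return_pmf (c j)) x)"

lemma pmf_dirac_mixture:
  assumes "\<And>j. j \<in> {1..V} \<Longrightarrow> 0 \<le> a j" and "(\<Sum>j=1..V. a j) = 1"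
  shows "pmf (dirac_mixture V c a) x = (\<Sum>j=1..V. a j * pmf (return_pmf (c j)) x)"
  unfolding dirac_mixture_def
proof (rule pmf_embed_pmf)
  show "0 \<le> (\<Sum>j=1..V. a j * pmf (return_pmf (c j)) x)" for x
    using assms(1) by (intro sum_nonneg mult_nonneg_nonneg) auto
  have "(\<integral>\<^sup>+x. ennreal (\<Sum>j=1..V. a j * pmf (return_pmf (c j)) x) \<partial>count_space UNIV)
      = (\<integral>\<^sup>+x. (\<Sum>j=1..V. ennreal (a j) * ennreal (pmf (return_pmf (c j)) x)) \<partial>count_space UNIV)"
  proof (rule nn_integral_cong)
    fix x
    have "ennreal (\<Sum>j=1..V. a j * pmf (return_pmf (c j)) x)
        = (\<Sum>j=1..V. ennreal (a j * pmf (return_pmf (c j)) x))"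
      by (rule sum_ennreal[symmetric]) (use assms(1) in \<open>auto intro: mult_nonneg_nonneg\<close>)
    also have "\<dots> = (\<Sum>j=1..V. ennreal (a j) * ennreal (pmf (return_pmf (c j)) x))"
      by (intro sum.cong refl ennreal_mult assms(1) pmf_nonneg)
    finally show "ennreal (\<Sum>j=1..V. a j * pmf (return_pmf (c j)) x)
        = (\<Sum>j=1..V. ennreal (a j) * ennreal (pmf (return_pmf (c j)) x))" .
  qed
  also have "\<dots> = (\<Sum>j=1..V. ennreal (a j) *
      (\<integral>\<^sup>+x. ennreal (pmf (return_pmf (c j)) x) \<partial>count_space UNIV))"
    by (simp add: nn_integral_sum nn_integral_cmult del: pmf_return)
  also have "\<dots> = (\<Sum>j=1..V. ennreal (a j))"
    by (simp add: nn_integral_pmf del: pmf_return)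
  also have "\<dots> = 1"
    using sum_ennreal[of "{1..V}" a] assms by (metis ennreal_1)
  finally show "(\<integral>\<^sup>+x. ennreal (\<Sum>j=1..V. a j * pmf (return_pmf (c j)) x) \<partial>count_space UNIV) = 1" .
qed

(* Joint distributions on S x S, encoded as Borel probability measures concentrated on S x S. *)
definition couplings ::
  "'s::real_normed_vector set \<Rightarrow> 's measure \<Rightarrow> 's measure \<Rightarrow> ('s \<times> 's) measure set" where
  "couplings S Q\<^sub>1 Q\<^sub>2 = {\<gamma>. prob_space \<gamma> \<and> sets \<gamma> = sets borel \<and> (AE z in \<gamma>. z \<in> S \<times> S) \<and>
     distr \<gamma> borel fst = Q\<^sub>1 \<and> distr \<gamma> borel snd = Q\<^sub>2}"

definition kantorovich ::
  "'s::real_normed_vector set \<Rightarrow> 's measure \<Rightarrow> 's measure \<Rightarrow> ennreal" where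
  "kantorovich S Q\<^sub>1 Q\<^sub>2 =
     (INF \<gamma>\<in>couplings S Q\<^sub>1 Q\<^sub>2. \<integral>\<^sup>+z. ennreal (norm (fst z - snd z)) \<partial>\<gamma>)"

definition borel_dist :: "'s::topological_space pmf \<Rightarrow> 's measure" where
  "borel_dist Q = distr (measure_pmf Q) borel (\<lambda>x. x)"

(* Distributions supported on the finite set A are represented as pmfs, so that every function
   of the state can be averaged, without a measurability assumption in the state variable. *)
definition kantorovich_ambiguity_set ::
  "'s::real_normed_vector set \<Rightarrow> 's set \<Rightarrow> 's pmf \<Rightarrow> real \<Rightarrow> 's pmf set" where
  "kantorovich_ambiguity_set S A Q\<^sub>0 r =
     {Q. set_pmf Q \<subseteq> A \<and> kantorovich S (borel_dist Q) (borel_dist Q\<^sub>0) \<le> ennreal r}"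

definition cum_prob :: "(nat \<Rightarrow> real) \<Rightarrow> nat \<Rightarrow> real" where
  "cum_prob p k = (\<Sum>i=1..<k. p i)"

definition spectral_weight :: "(real \<Rightarrow> real) \<Rightarrow> (nat \<Rightarrow> real) \<Rightarrow> nat \<Rightarrow> real" where
  "spectral_weight f p k = (LBINT t=ereal (cum_prob p k)..ereal (cum_prob p (k + 1)). f t)"

definition lp_feasible ::
  "nat \<Rightarrow> (nat \<Rightarrow> 's::real_normed_vector) \<Rightarrow> (nat \<Rightarrow> real) \<Rightarrow> real \<Rightarrow>
   ((nat \<Rightarrow> real) \<times> (nat \<Rightarrow> nat \<Rightarrow> real)) set" where
  "lp_feasible V c a r = {(q, w).
     (\<forall>i\<in>{1..V}. (\<Sum>j=1..V. w i j) = q i) \<and>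
     (\<forall>j\<in>{1..V}. (\<Sum>i=1..V. w i j) = a j) \<and>
     (\<Sum>i=1..V. \<Sum>j=1..V. w i j * norm (c i - c j)) \<le> r \<and>
     (\<Sum>i=1..V. q i) = 1 \<and>
     (\<forall>i\<in>{1..V}. \<forall>j\<in>{1..V}. 0 \<le> w i j) \<and>
     (\<forall>i\<in>{1..V}. 0 \<le> q i)}"

end

(* Under a coupling of two distributions on the centres, the point masses are transport weights.
   Since the centres need not be distinct, the mass at a pair of points is divided among the indices
   of these points, for the second marginal in proportion to the empirical cell frequencies.
   Conversely, feasible weights define a coupling on index pairs, pushed forward along the centres.
   The objectives agree because the quantile function of X equals x_k on (pi_k, pi_(k+1)]. *)

theory Submission
  imports Defs
begin

section \<open>Finite sums over fibres and measures concentrated on finite sets\<close>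

text \<open>Several indices may share a centre. Grouping them by their common point lets the weights
  \<open>u\<close> be totalled apart from \<open>F\<close>, which depends on the point
  alone.\<close>

lemma sum_fibres:
  fixes u :: "'i \<Rightarrow> real" and F :: "'a \<Rightarrow> real"
  assumes "finite I"
  shows "(\<Sum>i\<in>I. u i * F (c i)) = (\<Sum>y\<in>c ` I. F y * (\<Sum>i | i \<in> I \<and> c i = y. u i))"
proof -
  have "(\<Sum>i\<in>I. u i * F (c i)) = (\<Sum>y\<in>c ` I. \<Sum>i | i \<in> I \<and> c i = y. u i * F (c i))"
    using assms by (rule sum.image_gen)
  also have "\<dots> = (\<Sum>y\<in>c ` I. F y * (\<Sum>i | i \<in> I \<and> c i = y. u i))"
    by (intro sum.cong refl) (simp add: sum_distrib_left mult.commute)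
  finally show ?thesis .
qed

text \<open>Serves both the law of the loss, where it yields the distribution function, and
  couplings, where it yields the marginals.\<close>

lemma (in prob_space) measure_eq_sum_singletons:
  assumes "finite F" and "AE z in M. z \<in> F" and "\<And>z. z \<in> F \<Longrightarrow> {z} \<in> events" and "B \<in> events"
  shows "prob B = (\<Sum>z\<in>F \<inter> B. prob {z})"
proof -
  have FB: "F \<inter> B = (\<Union>z\<in>F \<inter> B. {z})" by blast
  have ev: "F \<inter> B \<in> events"
    using assms(1,3) by (subst FB) (intro sets.finite_UN; auto)
  have "prob B = prob (F \<inter> B)"
    using assms(2,4) ev by (intro finite_measure_eq_AE) auto
  also have "\<dots> = (\<Sum>z\<in>F \<inter> B. prob {z})"
    using assms(1,3) by (intro finite_measure_eq_sum_singleton) auto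
  finally show ?thesis .
qed

section \<open>Quantiles of a discrete loss\<close>

locale discrete_loss = prob_space M for M :: "'m measure" +
  fixes X :: "'m \<Rightarrow> real" and K :: nat and x p :: "nat \<Rightarrow> real"
  assumes X [measurable]: "X \<in> borel_measurable M"
    and mass: "\<And>k. k \<in> {1..K} \<Longrightarrow> prob {\<omega> \<in> space M. X \<omega> = x k} = p k"
    and total: "(\<Sum>k=1..K. p k) = 1"
    and mono_x: "strict_mono_on {1..K} x"
begin

lemma p_nonneg: "k \<in> {1..K} \<Longrightarrow> 0 \<le> p k"
  using mass[of k] by (metis measure_nonneg)

lemma inj_x: "inj_on x {1..K}"
  using mono_x by (rule strict_mono_on_imp_inj_on)

lemma cdf_eq: "cdf (distr M borel X) y = (\<Sum>k | k \<in> {1..K} \<and> x k \<le> y. p k)"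
proof -
  interpret D: prob_space "distr M borel X"
    by (rule prob_space_distr) simp
  have single: "D.prob {x k} = p k" if "k \<in> {1..K}" for k
    using mass[OF that] by (simp add: measure_distr vimage_def Int_def conj_commute)
  \<comment> \<open>The atoms already carry total mass 1, so the law of \<open>X\<close> is
    concentrated on the values \<open>x k\<close>; this is derived from
    \<open>total\<close>.\<close>
  have "D.prob (x ` {1..K}) = (\<Sum>z\<in>x ` {1..K}. D.prob {z})"
    by (intro D.finite_measure_eq_sum_singleton) auto
  also have "\<dots> = 1"
    unfolding sum.reindex[OF inj_x] comp_def total[symmetric] by (intro sum.cong refl single)
  finally have "AE z in distr M borel X. z \<in> x ` {1..K}"
    by (subst (asm) D.prob_eq_1) (auto intro: finite_imp_closed borel_closed)
  then have "cdf (distr M borel X) y = (\<Sum>z\<in>x ` {1..K} \<inter> {..y}. D.prob {z})"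
    unfolding cdf_def by (intro D.measure_eq_sum_singletons) auto
  also have "x ` {1..K} \<inter> {..y} = x ` {k. k \<in> {1..K} \<and> x k \<le> y}" by auto
  also have "(\<Sum>z\<in>\<dots>. D.prob {z}) = (\<Sum>k | k \<in> {1..K} \<and> x k \<le> y. p k)"
    by (subst sum.reindex) (auto intro: inj_on_subset[OF inj_x] simp: single intro!: sum.cong)
  finally show ?thesis .
qed

lemma cum_prob_mono: "i \<le> j \<Longrightarrow> j \<le> K + 1 \<Longrightarrow> cum_prob p i \<le> cum_prob p j"
  unfolding cum_prob_def by (rule sum_mono2) (auto intro!: p_nonneg)

lemma cum_prob_bounds:
  assumes "k \<in> {1..K + 1}"
  shows "0 \<le> cum_prob p k" and "cum_prob p k \<le> 1"
proof -
  have "cum_prob p (K + 1) = 1"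
    using total by (simp add: cum_prob_def atLeastLessThanSuc_atLeastAtMost)
  moreover have "cum_prob p 1 = 0" by (simp add: cum_prob_def)
  ultimately show "0 \<le> cum_prob p k" "cum_prob p k \<le> 1"
    using cum_prob_mono[of 1 k] cum_prob_mono[of k "K + 1"] assms by auto
qed

text \<open>For \<open>t\<close> in this cell the distribution function reaches level
  \<open>t\<close> exactly from \<open>x k\<close> onwards, so the infimum is taken over a closed
  half-line with left end \<open>x k\<close>.\<close>

lemma quantile_eq:
  assumes k: "k \<in> {1..K}" and t: "cum_prob p k < t" "t \<le> cum_prob p (k + 1)"
  shows "quantile M X t = x k"
proof -
  have "t \<le> cdf (distr M borel X) y \<longleftrightarrow> x k \<le> y" for y
  proof
    assume "x k \<le> y"
    then have "i \<in> {1..K} \<and> x i \<le> y" if "i \<in> {1..<k + 1}" for i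
      using that k strict_mono_onD[OF mono_x, of i k] by (cases "i = k") auto
    then have "cum_prob p (k + 1) \<le> cdf (distr M borel X) y"
      unfolding cum_prob_def cdf_eq by (intro sum_mono2) (auto intro: p_nonneg)
    with t show "t \<le> cdf (distr M borel X) y" by linarith
  next
    assume le: "t \<le> cdf (distr M borel X) y"
    show "x k \<le> y"
    proof (rule ccontr)
      assume less: "\<not> x k \<le> y"
      \<comment> \<open>Below \<open>x k\<close> only atoms with smaller index count, so the
        distribution function is at most \<open>cum_prob p k\<close>, which is strictly less than
        \<open>t\<close>.\<close>
      then have "i \<in> {1..<k}" if "i \<in> {1..K}" "x i \<le> y" for i
        using that k strict_mono_onD[OF mono_x, of k i] by (cases "i = k"; force)
      then have "cdf (distr M borel X) y \<le> cum_prob p k"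
        unfolding cum_prob_def cdf_eq using k by (intro sum_mono2) (auto intro: p_nonneg)
      with le t show False by linarith
    qed
  qed
  then have "{y. t \<le> cdf (distr M borel X) y} = {x k..}" by auto
  then show ?thesis by (simp add: quantile_def)
qed

text \<open>The half-open cells partition (0,1]; some may be empty because \<open>p k\<close> may
  vanish. The cell of \<open>t\<close> ends at the first cumulative probability that reaches
  \<open>t\<close>, and monotonicity makes it unique.\<close>

lemma cum_prob_cell:
  assumes "0 < t" "t \<le> 1"
  shows "\<exists>!k. k \<in> {1..K} \<and> cum_prob p k < t \<and> t \<le> cum_prob p (k + 1)"
proof -
  define m where "m = (LEAST k. t \<le> cum_prob p k)"
  have 1: "cum_prob p (K + 1) = 1"
    using total by (simp add: cum_prob_def atLeastLessThanSuc_atLeastAtMost)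
  then have m: "t \<le> cum_prob p m" "m \<le> K + 1"
    using LeastI[of "\<lambda>k. t \<le> cum_prob p k" "K + 1"]
      Least_le[of "\<lambda>k. t \<le> cum_prob p k" "K + 1"] assms unfolding m_def by auto
  have m2: "\<not> t \<le> cum_prob p k" if "k < m" for k
    using that unfolding m_def by (rule not_less_Least)
  \<comment> \<open>\<open>cum_prob\<close> is an empty sum at both 0 and 1, hence below
    \<open>t\<close>. So \<open>m\<close> is at least 2 and \<open>m - 1\<close> is a legitimate
    cell index.\<close>
  have "m \<noteq> 0" "m \<noteq> 1" using m(1) assms(1) by (intro notI; simp add: cum_prob_def)+
  then have ex: "m - 1 \<in> {1..K} \<and> cum_prob p (m - 1) < t \<and> t \<le> cum_prob p (m - 1 + 1)"
    using m m2[of "m - 1"] by auto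
  have uniq: "i = j" if "i \<in> {1..K} \<and> cum_prob p i < t \<and> t \<le> cum_prob p (i + 1)"
    "j \<in> {1..K} \<and> cum_prob p j < t \<and> t \<le> cum_prob p (j + 1)" for i j
    using that cum_prob_mono[of "i + 1" j] cum_prob_mono[of "j + 1" i]
    by (cases i j rule: linorder_cases) auto
  show ?thesis using ex uniq by blast
qed

lemma spectral_risk_eq:
  assumes "interval_lebesgue_integrable lborel 0 1 f"
  shows "spectral_risk M X f = (\<Sum>k=1..K. x k * spectral_weight f p k)"
proof -
  \<comment> \<open>Cutting \<open>f\<close> off outside (0,1) turns every integral below into one
    over the whole line of a single integrable function, so that linearity applies directly.\<close>
  define g where "g = (\<lambda>t. indicator {0<..<1} t * f t)"
  have g: "integrable lborel g"
    using assms
    by (simp add: interval_lebesgue_integrable_def set_integrable_def g_def zero_ereal_def one_ereal_def)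
  define I where "I k = {cum_prob p k<..cum_prob p (k + 1)}" for k
  have pointwise: "indicator {0<..<1} t * (quantile M X t * f t)
      = (\<Sum>k=1..K. x k * (indicator (I k) t * g t))" for t
  proof (cases "t \<in> {0<..<1}")
    case True
    then have "\<exists>!k. k \<in> {1..K} \<and> t \<in> I k"
      using cum_prob_cell[of t] by (simp add: I_def)
    then obtain k where k: "k \<in> {1..K}" "t \<in> I k"
      and uniq: "\<And>i. i \<in> {1..K} \<Longrightarrow> t \<in> I i \<Longrightarrow> i = k"
      by blast
    have "(\<Sum>i=1..K. x i * (indicator (I i) t * g t)) = (\<Sum>i=1..K. if i = k then x k * g t else 0)"
    proof (intro sum.cong refl)
      fix i assume "i \<in> {1..K}"
      with uniq have "t \<in> I i \<longleftrightarrow> i = k" using k(2) by blast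
      then show "x i * (indicator (I i) t * g t) = (if i = k then x k * g t else 0)"
        using k(2) by auto
    qed
    also have "\<dots> = x k * g t" using k by simp
    also have "x k = quantile M X t"
      using k quantile_eq[of k t] by (simp add: I_def)
    finally show ?thesis by (simp add: g_def)
  qed (simp add: g_def)
  \<comment> \<open>The open interval between the cell ends lies in (0,1), where \<open>g\<close>
    and \<open>f\<close> agree; the right end added in \<open>I k\<close> is a null set.\<close>
  have piece: "spectral_weight f p k = (\<integral>t. indicator (I k) t * g t \<partial>lborel)" if "k \<in> {1..K}" for k
  proof -
    have le: "ereal (cum_prob p k) \<le> ereal (cum_prob p (k + 1))"
      and b: "0 \<le> cum_prob p k" "cum_prob p (k + 1) \<le> 1"
      using that cum_prob_mono[of k "k + 1"] cum_prob_bounds[of k] cum_prob_bounds[of "k + 1"] by auto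
    have "spectral_weight f p k
        = (LBINT t=ereal (cum_prob p k)..ereal (cum_prob p (k + 1)). g t)"
      unfolding spectral_weight_def using le b
      by (intro interval_integral_cong) (auto simp: g_def min_def max_def indicator_def)
    also have "\<dots> = (\<integral>t. indicator (I k) t * g t \<partial>lborel)"
      using le by (simp add: interval_integral_Ioc set_lebesgue_integral_def I_def)
    finally show ?thesis .
  qed
  have int: "integrable lborel (\<lambda>t. indicator (I k) t * g t)" for k
    using integrable_mult_indicator[OF _ g, of "I k"] by (simp add: I_def)
  have "spectral_risk M X f = (\<integral>t. indicator {0<..<1} t * (quantile M X t * f t) \<partial>lborel)"
    by (simp add: spectral_risk_def interval_lebesgue_integral_def set_lebesgue_integral_def
        zero_ereal_def one_ereal_def)
  also have "\<dots> = (\<Sum>k=1..K. x k * (\<integral>t. indicator (I k) t * g t \<partial>lborel))"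
    unfolding pointwise using int by (simp add: Bochner_Integration.integral_sum)
  also have "\<dots> = (\<Sum>k=1..K. x k * spectral_weight f p k)"
    by (intro sum.cong refl) (simp add: piece)
  finally show ?thesis .
qed

end


section \<open>Couplings of Dirac mixtures\<close>

lemma pmf_dirac_mixture_fibre:
  assumes "\<And>j. j \<in> {1..V} \<Longrightarrow> 0 \<le> a j" and "(\<Sum>j=1..V. a j) = 1"
  shows "pmf (dirac_mixture V c a) y = (\<Sum>j | j \<in> {1..V} \<and> c j = y. a j)"
proof -
  have "pmf (dirac_mixture V c a) y = (\<Sum>j=1..V. a j * pmf (return_pmf (c j)) y)"
    using assms by (rule pmf_dirac_mixture)
  also have "\<dots> = (\<Sum>j\<in>{1..V}. if c j = y then a j else 0)"
    by (intro sum.cong refl) simp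
  also have "\<dots> = (\<Sum>j\<in>{j \<in> {1..V}. c j = y}. a j)"
    by (rule sum.inter_filter[symmetric]) simp
  finally show ?thesis by simp
qed

lemma set_dirac_mixture:
  assumes "\<And>j. j \<in> {1..V} \<Longrightarrow> 0 \<le> a j" and "(\<Sum>j=1..V. a j) = 1"
  shows "set_pmf (dirac_mixture V c a) \<subseteq> c ` {1..V}"
proof
  fix y assume "y \<in> set_pmf (dirac_mixture V c a)"
  then have "(\<Sum>j | j \<in> {1..V} \<and> c j = y. a j) \<noteq> 0"
    by (subst pmf_dirac_mixture_fibre[OF assms, symmetric]) (auto simp: set_pmf_iff)
  then have "{j. j \<in> {1..V} \<and> c j = y} \<noteq> {}" by (metis sum.empty)
  then show "y \<in> c ` {1..V}" by blast
qed

lemma measure_borel_dist_singleton: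
  "measure (borel_dist Q) {y :: 's::t1_space} = pmf Q y"
  by (simp add: borel_dist_def measure_distr pmf.rep_eq)

lemma AE_borel_dist:
  fixes Q :: "'s::t1_space pmf"
  assumes "set_pmf Q \<subseteq> A" and "finite A"
  shows "AE y in borel_dist Q. y \<in> A"
  unfolding borel_dist_def using assms
  by (subst AE_distr_iff) (auto simp: AE_measure_pmf_iff intro: finite_imp_closed borel_closed)

section \<open>Transport weights from a coupling\<close>

text \<open>Column sums must return each individual \<open>a j\<close>, which forces the
  proportional split in the second index. Rows carry no such prescription, so an even split works.
  Sums against \<open>h\<close> survive because \<open>h\<close> sees only the points and the shares
  over a fibre add up to 1 wherever \<open>W\<close> has mass.\<close>

lemma split_coupling_weights:
  fixes W :: "'s \<Rightarrow> 's \<Rightarrow> real" and c :: "nat \<Rightarrow> 's" and a :: "nat \<Rightarrow> real"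
  assumes a: "\<And>j. j \<in> {1..V} \<Longrightarrow> 0 \<le> a j"
    and W: "\<And>x y. 0 \<le> W x y"
    and col: "\<And>y. y \<in> c ` {1..V} \<Longrightarrow>
      (\<Sum>x\<in>c ` {1..V}. W x y) = (\<Sum>j | j \<in> {1..V} \<and> c j = y. a j)"
  obtains w where "\<And>i j. i \<in> {1..V} \<Longrightarrow> j \<in> {1..V} \<Longrightarrow> 0 \<le> w i j"
    and "\<And>j. j \<in> {1..V} \<Longrightarrow> (\<Sum>i=1..V. w i j) = a j"
    and "\<And>h :: 's \<Rightarrow> 's \<Rightarrow> real. (\<Sum>i=1..V. \<Sum>j=1..V. w i j * h (c i) (c j)) =
      (\<Sum>x\<in>c ` {1..V}. \<Sum>y\<in>c ` {1..V}. W x y * h x y)"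
proof -
  define A where "A = c ` {1..V}"
  define fib where "fib y = {j. j \<in> {1..V} \<and> c j = y}" for y
  define B where "B y = (\<Sum>j\<in>fib y. a j)" for y
  define u where "u i = 1 / real (card (fib (c i)))" for i
  define v where "v j = a j / B (c j)" for j
  have fin: "finite (fib y)" for y by (simp add: fib_def)
  have fibres: "(\<Sum>i=1..V. t i * F (c i)) = (\<Sum>y\<in>A. F y * (\<Sum>i\<in>fib y. t i))"
    for t :: "nat \<Rightarrow> real" and F
    unfolding A_def fib_def by (rule sum_fibres) simp
  have B0: "0 \<le> B y" for y
    unfolding B_def by (intro sum_nonneg) (auto simp: fib_def intro: a)
  have aB: "a j \<le> B (c j)" if "j \<in> {1..V}" for j
    unfolding B_def using that fin by (intro member_le_sum) (auto simp: fib_def intro: a)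
  have colA: "(\<Sum>x\<in>A. W x y) = B y" if "y \<in> A" for y
    using col that by (simp add: A_def B_def fib_def)
  have WB: "W x y \<le> B y" if "x \<in> A" "y \<in> A" for x y
    unfolding colA[OF that(2), symmetric] using that W
    by (intro member_le_sum) (auto simp: A_def)
  have u1: "(\<Sum>i\<in>fib y. u i) = 1" if "y \<in> A" for y
  proof -
    have "(\<Sum>i\<in>fib y. u i) = (\<Sum>i\<in>fib y. 1 / real (card (fib y)))"
      by (intro sum.cong) (auto simp: u_def fib_def)
    moreover have "fib y \<noteq> {}" using that by (auto simp: A_def fib_def)
    ultimately show ?thesis using fin by simp
  qed
  \<comment> \<open>The shares \<open>v\<close> add up to 1 only if \<open>B y\<close> is nonzero.
    Otherwise division by zero makes them 0, but then \<open>WB\<close> forces \<open>W x y\<close>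
    to be 0 too; hence the factor \<open>W x y\<close> in the claim.\<close>
  have v1: "W x y * (\<Sum>j\<in>fib y. v j) = W x y" if "x \<in> A" "y \<in> A" for x y
  proof -
    have "(\<Sum>j\<in>fib y. v j) = (\<Sum>j\<in>fib y. a j / B y)"
      by (intro sum.cong) (auto simp: v_def fib_def)
    also have "\<dots> = B y / B y" unfolding B_def by (rule sum_divide_distrib[symmetric])
    finally show ?thesis using WB[OF that] W[of x y] by (cases "B y = 0") simp_all
  qed
  define w where "w i j = u i * v j * W (c i) (c j)" for i j
  show ?thesis
  proof (rule that[of w])
    show "0 \<le> w i j" if "i \<in> {1..V}" "j \<in> {1..V}" for i j
      using that a B0 W by (simp add: w_def u_def v_def)
    show "(\<Sum>i=1..V. w i j) = a j" if j: "j \<in> {1..V}" for j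
    proof -
      have "(\<Sum>i=1..V. w i j) = (\<Sum>i=1..V. u i * (v j * W (c i) (c j)))"
        by (simp add: w_def mult.assoc)
      also have "\<dots> = (\<Sum>x\<in>A. v j * W x (c j) * (\<Sum>i\<in>fib x. u i))"
        by (rule fibres)
      also have "\<dots> = (\<Sum>x\<in>A. v j * W x (c j))" by (simp add: u1)
      also have "\<dots> = v j * B (c j)"
        using j by (subst colA[symmetric]) (auto simp: A_def sum_distrib_left)
      \<comment> \<open>If \<open>B (c j)\<close> is 0, then \<open>v j\<close> is 0 by convention,
        and \<open>a j\<close> is 0 as well, being squeezed between 0 and
        \<open>B (c j)\<close>.\<close>
      also have "\<dots> = a j" using aB[OF j] a[OF j] by (auto simp: v_def)
      finally show ?thesis .
    qed
    fix h :: "'s \<Rightarrow> 's \<Rightarrow> real"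
    \<comment> \<open>The fibres are summed out in turn: first over \<open>i\<close>, with the inner
      sum read as a function of the point \<open>c i\<close>, then over \<open>j\<close>.\<close>
    have "(\<Sum>i=1..V. \<Sum>j=1..V. w i j * h (c i) (c j))
        = (\<Sum>i=1..V. u i * (\<Sum>j=1..V. v j * (W (c i) (c j) * h (c i) (c j))))"
      by (simp add: w_def sum_distrib_left mult.assoc)
    also have "\<dots> = (\<Sum>x\<in>A. (\<Sum>j=1..V. v j * (W x (c j) * h x (c j))) * (\<Sum>i\<in>fib x. u i))"
      by (rule fibres)
    also have "\<dots> = (\<Sum>x\<in>A. \<Sum>y\<in>A. W x y * h x y * (\<Sum>j\<in>fib y. v j))"
    proof (intro sum.cong refl)
      fix x assume "x \<in> A"
      then show "(\<Sum>j=1..V. v j * (W x (c j) * h x (c j))) * (\<Sum>i\<in>fib x. u i)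
          = (\<Sum>y\<in>A. W x y * h x y * (\<Sum>j\<in>fib y. v j))"
        using fibres[of v "\<lambda>y. W x y * h x y"] by (simp add: u1)
    qed
    also have "\<dots> = (\<Sum>x\<in>A. \<Sum>y\<in>A. W x y * h x y)"
    proof (intro sum.cong refl)
      fix x y assume "x \<in> A" "y \<in> A"
      then have "W x y * (\<Sum>j\<in>fib y. v j) * h x y = W x y * h x y"
        by (simp only: v1)
      then show "W x y * h x y * (\<Sum>j\<in>fib y. v j) = W x y * h x y"
        by (simp only: mult_ac)
    qed
    finally show "(\<Sum>i=1..V. \<Sum>j=1..V. w i j * h (c i) (c j)) =
      (\<Sum>x\<in>c ` {1..V}. \<Sum>y\<in>c ` {1..V}. W x y * h x y)" by (simp add: A_def)
  qed
qed

text \<open>Both marginals live on the finite set \<open>A\<close>, so the coupling is concentrated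
  on \<open>A \<times> A\<close> and its point masses form a transport matrix.\<close>

lemma coupling_weights:
  fixes Q\<^sub>1 Q\<^sub>2 :: "'s::euclidean_space pmf"
  assumes \<gamma>: "\<gamma> \<in> couplings S (borel_dist Q\<^sub>1) (borel_dist Q\<^sub>2)"
    and A: "finite A" "set_pmf Q\<^sub>1 \<subseteq> A" "set_pmf Q\<^sub>2 \<subseteq> A"
    and cost: "(\<integral>\<^sup>+z. ennreal (norm (fst z - snd z)) \<partial>\<gamma>) \<le> ennreal \<rho>" "0 \<le> \<rho>"
  shows "x \<in> A \<Longrightarrow> (\<Sum>y\<in>A. measure \<gamma> {(x, y)}) = pmf Q\<^sub>1 x"
    and "y \<in> A \<Longrightarrow> (\<Sum>x\<in>A. measure \<gamma> {(x, y)}) = pmf Q\<^sub>2 y"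
    and "(\<Sum>x\<in>A. \<Sum>y\<in>A. measure \<gamma> {(x, y)} * norm (x - y)) \<le> \<rho>"
proof -
  interpret prob_space \<gamma> using \<gamma> by (simp add: couplings_def)
  have sets [measurable_cong]: "sets \<gamma> = sets borel"
    and marg: "distr \<gamma> borel fst = borel_dist Q\<^sub>1" "distr \<gamma> borel snd = borel_dist Q\<^sub>2"
    using \<gamma> by (auto simp: couplings_def)
  have space: "space \<gamma> = UNIV" using sets_eq_imp_space_eq[OF sets] by simp
  have [measurable]: "fst \<in> \<gamma> \<rightarrow>\<^sub>M borel" "snd \<in> \<gamma> \<rightarrow>\<^sub>M borel"
    unfolding measurable_cong_sets[OF sets refl]
    by (intro borel_measurable_continuous_onI continuous_intros)+
  have "AE z in \<gamma>. fst z \<in> A" "AE z in \<gamma>. snd z \<in> A"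
    using AE_borel_dist[OF A(2,1)] AE_borel_dist[OF A(3,1)] unfolding marg[symmetric]
    by (auto dest: AE_distrD[rotated])
  then have AA: "AE z in \<gamma>. z \<in> A \<times> A"
    by eventually_elim (auto simp: mem_Times_iff)
  have single: "{z} \<in> events" for z by (simp add: sets)
  show "(\<Sum>y\<in>A. prob {(x, y)}) = pmf Q\<^sub>1 x" if "x \<in> A" for x
  proof -
    have "pmf Q\<^sub>1 x = prob (fst -` {x} \<inter> space \<gamma>)"
      unfolding measure_borel_dist_singleton[symmetric] marg(1)[symmetric] by (subst measure_distr) auto
    also have "\<dots> = (\<Sum>z\<in>A \<times> A \<inter> (fst -` {x} \<inter> space \<gamma>). prob {z})"
      using A(1) AA single by (intro measure_eq_sum_singletons) auto
    also have "A \<times> A \<inter> (fst -` {x} \<inter> space \<gamma>) = Pair x ` A" using that by (auto simp: space)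
    finally show ?thesis by (simp add: sum.reindex inj_on_def)
  qed
  show "(\<Sum>x\<in>A. prob {(x, y)}) = pmf Q\<^sub>2 y" if "y \<in> A" for y
  proof -
    have "pmf Q\<^sub>2 y = prob (snd -` {y} \<inter> space \<gamma>)"
      unfolding measure_borel_dist_singleton[symmetric] marg(2)[symmetric] by (subst measure_distr) auto
    also have "\<dots> = (\<Sum>z\<in>A \<times> A \<inter> (snd -` {y} \<inter> space \<gamma>). prob {z})"
      using A(1) AA single by (intro measure_eq_sum_singletons) auto
    also have "A \<times> A \<inter> (snd -` {y} \<inter> space \<gamma>) = (\<lambda>x. (x, y)) ` A" using that by (auto simp: space)
    finally show ?thesis by (simp add: sum.reindex inj_on_def)
  qed
  have "ennreal (\<Sum>z\<in>A \<times> A. prob {z} * norm (fst z - snd z))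
      = (\<Sum>z\<in>A \<times> A. ennreal (norm (fst z - snd z)) * emeasure \<gamma> {z})"
    by (subst sum_ennreal[symmetric])
      (auto simp: emeasure_eq_measure ennreal_mult mult.commute intro!: sum.cong)
  \<comment> \<open>The weighted point masses are the integral of a simple function that equals the
    distance on \<open>A \<times> A\<close> and 0 elsewhere, hence lies below the cost
    integrand.\<close>
  also have "\<dots> = (\<integral>\<^sup>+z. (\<Sum>z'\<in>A \<times> A. ennreal (norm (fst z' - snd z')) * indicator {z'} z) \<partial>\<gamma>)"
    using single by (subst nn_integral_sum) (auto simp: nn_integral_cmult_indicator)
  also have "\<dots> \<le> (\<integral>\<^sup>+z. ennreal (norm (fst z - snd z)) \<partial>\<gamma>)"
  proof (intro nn_integral_mono)
    fix z
    have "(\<Sum>z'\<in>A \<times> A. ennreal (norm (fst z' - snd z')) * indicator {z'} z)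
        = (\<Sum>z'\<in>A \<times> A. if z' = z then ennreal (norm (fst z - snd z)) else 0)"
      by (intro sum.cong) (auto simp: indicator_def)
    also have "\<dots> \<le> ennreal (norm (fst z - snd z))"
      using A(1) by (subst sum.delta) auto
    finally show "(\<Sum>z'\<in>A \<times> A. ennreal (norm (fst z' - snd z')) * indicator {z'} z)
        \<le> ennreal (norm (fst z - snd z))" .
  qed
  also note cost(1)
  finally show "(\<Sum>x\<in>A. \<Sum>y\<in>A. prob {(x, y)} * norm (x - y)) \<le> \<rho>"
    using cost(2) by (simp add: sum.cartesian_product case_prod_beta)
qed

section \<open>A coupling from feasible weights\<close>

text \<open>The weights are a joint law of index pairs. Working with indices avoids any case
  distinction for repeated centres: the push-forward along \<open>c\<close> adds up their masses by
  itself.\<close>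

lemma lp_feasible_imp_ambiguity:
  fixes c :: "nat \<Rightarrow> 's::euclidean_space"
  assumes c: "\<And>j. j \<in> {1..V} \<Longrightarrow> c j \<in> S"
    and a: "\<And>j. j \<in> {1..V} \<Longrightarrow> 0 \<le> a j" "(\<Sum>j=1..V. a j) = 1"
    and qw: "(q, w) \<in> lp_feasible V c a r"
  obtains Q where "Q \<in> kantorovich_ambiguity_set S (c ` {1..V}) (dirac_mixture V c a) r"
    and "\<And>g. measure_pmf.expectation Q g = (\<Sum>i=1..V. q i * g (c i))"
proof -
  let ?I = "{1..V} \<times> {1..V}"
  from qw have row: "\<And>i. i \<in> {1..V} \<Longrightarrow> (\<Sum>j=1..V. w i j) = q i"
    and col: "\<And>j. j \<in> {1..V} \<Longrightarrow> (\<Sum>i=1..V. w i j) = a j"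
    and cost: "(\<Sum>i=1..V. \<Sum>j=1..V. w i j * norm (c i - c j)) \<le> r"
    and q1: "(\<Sum>i=1..V. q i) = 1"
    and w: "\<And>i j. i \<in> {1..V} \<Longrightarrow> j \<in> {1..V} \<Longrightarrow> 0 \<le> w i j"
    unfolding lp_feasible_def by blast+
  \<comment> \<open>Extension of \<open>w\<close> by zero to all index pairs; its total mass is 1
    since the row sums are \<open>q i\<close> and these add up to 1.\<close>
  define f where "f z = (if z \<in> ?I then w (fst z) (snd z) else 0)" for z
  define P where "P = embed_pmf f"
  have f0: "0 \<le> f z" for z using w by (auto simp: f_def)
  have f_sum: "(\<Sum>z\<in>?I. f z) = 1"
  proof -
    have "(\<Sum>z\<in>?I. f z) = (\<Sum>i=1..V. \<Sum>j=1..V. w i j)"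
      by (simp add: sum.cartesian_product f_def case_prod_beta)
    also have "\<dots> = 1" using row q1 by simp
    finally show ?thesis .
  qed
  have "(\<integral>\<^sup>+z. ennreal (f z) \<partial>count_space UNIV) = (\<Sum>z\<in>?I. ennreal (f z))"
    by (rule nn_integral_count_space') (auto simp: f_def)
  also have "\<dots> = 1" using f0 f_sum by (simp add: sum_ennreal)
  finally have pmfP: "pmf P z = f z" for z
    unfolding P_def using f0 by (intro pmf_embed_pmf) auto
  have supp: "set_pmf P \<subseteq> ?I" by (auto simp: set_pmf_iff pmfP f_def split: if_splits)
  have expP: "measure_pmf.expectation P h = (\<Sum>i=1..V. \<Sum>j=1..V. w i j * h (i, j))"
    for h :: "nat \<times> nat \<Rightarrow> real"
  proof -
    have "measure_pmf.expectation P h = (\<Sum>z\<in>?I. pmf P z *\<^sub>R h z)"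
      using supp by (intro integral_measure_pmf) auto
    then show ?thesis by (simp add: sum.cartesian_product pmfP f_def case_prod_beta)
  qed
  define Q where "Q = map_pmf (\<lambda>z. c (fst z)) P"
  have Q0: "dirac_mixture V c a = map_pmf (\<lambda>z. c (snd z)) P"
  proof (rule pmf_eqI)
    fix y
    have "pmf (map_pmf (\<lambda>z. c (snd z)) P) y
        = measure_pmf.expectation P (indicator ((\<lambda>z. c (snd z)) -` {y}))"
      by (simp add: pmf_map)
    also have "\<dots> = (\<Sum>j=1..V. \<Sum>i=1..V. w i j * indicator {y} (c j))"
      unfolding expP by (subst sum.swap) (simp add: indicator_def)
    also have "\<dots> = (\<Sum>j=1..V. a j * indicator {y} (c j))"
      by (intro sum.cong refl) (simp only: sum_distrib_right[symmetric] col)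
    also have "\<dots> = pmf (dirac_mixture V c a) y"
      using a by (subst pmf_dirac_mixture) (auto intro!: sum.cong simp: indicator_def)
    finally show "pmf (dirac_mixture V c a) y = pmf (map_pmf (\<lambda>z. c (snd z)) P) y" ..
  qed
  define \<gamma> where "\<gamma> = distr (measure_pmf P) borel (\<lambda>z. (c (fst z), c (snd z)))"
  have [measurable]: "fst \<in> borel_measurable (borel :: ('s \<times> 's) measure)"
    "snd \<in> borel_measurable (borel :: ('s \<times> 's) measure)"
    by (auto intro!: borel_measurable_continuous_onI continuous_intros)
  have "prob_space \<gamma>"
    unfolding \<gamma>_def by (rule measure_pmf.prob_space_distr) simp
  moreover have "AE z in \<gamma>. z \<in> S \<times> S"
  proof -
    \<comment> \<open>\<open>S\<close> is an arbitrary set here, so the almost-sure statement is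
      transferred through a finite, hence Borel, subset of \<open>S \<times> S\<close>.\<close>
    define D where "D = c ` {1..V} \<times> c ` {1..V}"
    have "D \<in> sets borel"
      unfolding D_def by (intro borel_closed finite_imp_closed) simp
    moreover have "AE z in measure_pmf P. (c (fst z), c (snd z)) \<in> D"
      using supp by (auto simp: AE_measure_pmf_iff D_def)
    ultimately have "AE z in \<gamma>. z \<in> D"
      unfolding \<gamma>_def by (subst AE_distr_iff) auto
    then show ?thesis by eventually_elim (use c in \<open>auto simp: D_def\<close>)
  qed
  moreover have "distr \<gamma> borel fst = borel_dist Q"
    "distr \<gamma> borel snd = borel_dist (dirac_mixture V c a)"
    unfolding \<gamma>_def borel_dist_def Q0 Q_def map_pmf_rep_eq
    by (simp_all add: distr_distr comp_def)
  ultimately have "\<gamma> \<in> couplings S (borel_dist Q) (borel_dist (dirac_mixture V c a))"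
    unfolding couplings_def by (simp add: \<gamma>_def[THEN arg_cong[where f = sets]])
  then have "kantorovich S (borel_dist Q) (borel_dist (dirac_mixture V c a))
      \<le> (\<integral>\<^sup>+z. ennreal (norm (fst z - snd z)) \<partial>\<gamma>)"
    unfolding kantorovich_def by (rule INF_lower)
  also have "\<dots> = (\<integral>\<^sup>+z. ennreal (norm (c (fst z) - c (snd z))) \<partial>measure_pmf P)"
    unfolding \<gamma>_def by (subst nn_integral_distr) auto
  \<comment> \<open>\<open>P\<close> has finite support, so the cost is integrable and its
    expectation is the finite double sum bounded by \<open>r\<close>.\<close>
  also have "\<dots> = ennreal (measure_pmf.expectation P (\<lambda>z. norm (c (fst z) - c (snd z))))"
    using finite_subset[OF supp] by (intro nn_integral_eq_integral integrable_measure_pmf_finite) auto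
  also have "\<dots> \<le> ennreal r" unfolding expP using cost by (intro ennreal_leI) simp
  finally have "Q \<in> kantorovich_ambiguity_set S (c ` {1..V}) (dirac_mixture V c a) r"
    using supp by (auto simp: kantorovich_ambiguity_set_def Q_def)
  moreover have "measure_pmf.expectation Q g = (\<Sum>i=1..V. q i * g (c i))" for g
  proof -
    have "measure_pmf.expectation Q g = (\<Sum>i=1..V. (\<Sum>j=1..V. w i j) * g (c i))"
      by (simp add: Q_def expP sum_distrib_right)
    then show ?thesis using row by simp
  qed
  ultimately show ?thesis by (rule that)
qed

text \<open>The mixture with the diagonal coupling makes it unnecessary to show that the infimum defining the
  Kantorovich metric is attained: a coupling whose cost slightly exceeds the radius becomes feasible.\<close>

lemma ambiguity_imp_lp_feasible:
  fixes c :: "nat \<Rightarrow> 's::euclidean_space"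
  assumes a: "\<And>j. j \<in> {1..V} \<Longrightarrow> 0 \<le> a j" "(\<Sum>j=1..V. a j) = 1"
    and r: "0 < r" and l: "0 < l" "l < 1"
    and Q: "Q \<in> kantorovich_ambiguity_set S (c ` {1..V}) (dirac_mixture V c a) r"
  obtains q w where "(q, w) \<in> lp_feasible V c a r"
    and "\<And>g. (\<Sum>i=1..V. q i * g (c i)) =
      (1 - l) * measure_pmf.expectation Q g + l * (\<Sum>i=1..V. a i * g (c i))"
proof -
  let ?A = "c ` {1..V}"
  let ?Q0 = "dirac_mixture V c a"
  \<comment> \<open>Chosen so that scaling by \<open>1 - l\<close> brings a cost of
    \<open>\<rho>\<close> back to \<open>r\<close>. As \<open>\<rho>\<close> exceeds
    \<open>r\<close>, some coupling costs at most \<open>\<rho>\<close> even if the infimum is not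
    attained.\<close>
  define \<rho> where "\<rho> = r / (1 - l)"
  have \<rho>: "0 \<le> \<rho>" "r < \<rho>" "(1 - l) * \<rho> = r" using r l by (auto simp: \<rho>_def field_simps)
  have suppQ: "set_pmf Q \<subseteq> ?A"
    and "kantorovich S (borel_dist Q) (borel_dist ?Q0) \<le> ennreal r"
    using Q by (auto simp: kantorovich_ambiguity_set_def)
  then have "kantorovich S (borel_dist Q) (borel_dist ?Q0) < ennreal \<rho>"
    using \<rho> r by (intro le_less_trans[OF _ ennreal_lessI]) auto
  then obtain \<gamma> where \<gamma>: "\<gamma> \<in> couplings S (borel_dist Q) (borel_dist ?Q0)"
    and \<gamma>_cost: "(\<integral>\<^sup>+z. ennreal (norm (fst z - snd z)) \<partial>\<gamma>) \<le> ennreal \<rho>"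
    unfolding kantorovich_def by (subst (asm) INF_less_iff) (auto intro: less_imp_le)
  have suppQ0: "set_pmf ?Q0 \<subseteq> ?A" by (rule set_dirac_mixture[OF a])
  define W where "W x y = measure \<gamma> {(x, y)}" for x y
  note cw = coupling_weights[OF \<gamma> _ suppQ suppQ0 \<gamma>_cost \<rho>(1), folded W_def]
  have "(\<Sum>x\<in>?A. W x y) = (\<Sum>j | j \<in> {1..V} \<and> c j = y. a j)" if "y \<in> ?A" for y
    using cw(2)[OF _ that] pmf_dirac_mixture_fibre[OF a, of c y] by simp
  then obtain w where w: "\<And>i j. i \<in> {1..V} \<Longrightarrow> j \<in> {1..V} \<Longrightarrow> 0 \<le> w i j"
    and w_col: "\<And>j. j \<in> {1..V} \<Longrightarrow> (\<Sum>i=1..V. w i j) = a j"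
    and w_sum: "\<And>h :: 's \<Rightarrow> 's \<Rightarrow> real. (\<Sum>i=1..V. \<Sum>j=1..V. w i j * h (c i) (c j)) =
      (\<Sum>x\<in>?A. \<Sum>y\<in>?A. W x y * h x y)"
    using split_coupling_weights[of V a W c] a(1) by (auto simp: W_def)
  \<comment> \<open>The diagonal part leaves all mass in place: both its marginals are
    \<open>a\<close> and it costs nothing. Column sums therefore stay \<open>a j\<close>, while the
    cost shrinks by the factor \<open>1 - l\<close>.\<close>
  define w' where "w' i j = (1 - l) * w i j + l * (if i = j then a j else 0)" for i j
  define q where "q i = (\<Sum>j=1..V. w' i j)" for i
  have q_eq: "q i = (1 - l) * (\<Sum>j=1..V. w i j) + l * a i" if "i \<in> {1..V}" for i
    using that by (simp add: q_def w'_def sum.distrib sum_distrib_left[symmetric])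
  have w'_col: "(\<Sum>i=1..V. w' i j) = a j" if "j \<in> {1..V}" for j
    using that w_col[OF that]
    by (simp add: w'_def sum.distrib sum_distrib_left[symmetric]) (simp add: left_diff_distrib)
  have w'_nonneg: "0 \<le> w' i j" if "i \<in> {1..V}" "j \<in> {1..V}" for i j
    using that l w a(1) by (simp add: w'_def)
  have "(\<Sum>i=1..V. \<Sum>j=1..V. w' i j * norm (c i - c j))
      = (1 - l) * (\<Sum>i=1..V. \<Sum>j=1..V. w i j * norm (c i - c j))"
    unfolding sum_distrib_left by (intro sum.cong refl) (auto simp: w'_def)
  also have "\<dots> \<le> (1 - l) * \<rho>"
    unfolding w_sum[of "\<lambda>x y. norm (x - y)"] using l cw(3) by (intro mult_left_mono) simp_all
  finally have cost: "(\<Sum>i=1..V. \<Sum>j=1..V. w' i j * norm (c i - c j)) \<le> r" by (simp add: \<rho>)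
  have "(\<Sum>i=1..V. q i) = (\<Sum>j=1..V. \<Sum>i=1..V. w' i j)"
    unfolding q_def by (rule sum.swap)
  also have "\<dots> = 1" using w'_col a(2) by simp
  finally have "(q, w') \<in> lp_feasible V c a r"
    using w'_col w'_nonneg cost by (auto simp: lp_feasible_def q_def intro!: sum_nonneg)
  moreover have "(\<Sum>i=1..V. q i * g (c i)) =
      (1 - l) * measure_pmf.expectation Q g + l * (\<Sum>i=1..V. a i * g (c i))" for g
  proof -
    have "measure_pmf.expectation Q g = (\<Sum>x\<in>?A. g x * pmf Q x)"
      using suppQ by (intro integral_measure_pmf_real) auto
    \<comment> \<open>A function of the first point alone is a special \<open>h\<close> in
      \<open>w_sum\<close>, which carries the expectation under \<open>Q\<close> over to the row
      sums of \<open>w\<close>.\<close>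
    also have "\<dots> = (\<Sum>x\<in>?A. \<Sum>y\<in>?A. W x y * g x)"
      by (intro sum.cong refl) (simp add: cw(1)[symmetric] sum_distrib_left mult.commute)
    also have "\<dots> = (\<Sum>i=1..V. (\<Sum>j=1..V. w i j) * g (c i))"
      by (simp only: w_sum[of "\<lambda>x y. g x", symmetric] sum_distrib_right)
    finally have E: "measure_pmf.expectation Q g = (\<Sum>i=1..V. (\<Sum>j=1..V. w i j) * g (c i))" .
    have "(\<Sum>i=1..V. q i * g (c i))
        = (\<Sum>i=1..V. (1 - l) * ((\<Sum>j=1..V. w i j) * g (c i)) + l * (a i * g (c i)))"
      by (intro sum.cong refl) (simp only: q_eq distrib_right mult.assoc)
    then show ?thesis by (simp only: E sum.distrib sum_distrib_left)
  qed
  ultimately show ?thesis by (rule that)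
qed

section \<open>Equality of the two suprema\<close>

text \<open>Feasible weights give a distribution with the same objective. Conversely, each
  distribution is matched only up to a mixture with the nominal one, and the error disappears as the
  mixing weight tends to 0. Suprema in \<open>ereal\<close> spare any discussion of
  boundedness.\<close>

lemma SUP_ambiguity_eq_SUP_lp:
  fixes c :: "nat \<Rightarrow> 's::euclidean_space"
  assumes c: "\<And>j. j \<in> {1..V} \<Longrightarrow> c j \<in> S"
    and a: "\<And>j. j \<in> {1..V} \<Longrightarrow> 0 \<le> a j" "(\<Sum>j=1..V. a j) = 1"
    and r: "0 < r"
  shows "(SUP Q \<in> kantorovich_ambiguity_set S (c ` {1..V}) (dirac_mixture V c a) r.
            ereal (measure_pmf.expectation Q g))
       = (SUP (q, w) \<in> lp_feasible V c a r. ereal (\<Sum>i=1..V. q i * g (c i)))"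
    (is "?L = ?R")
proof (rule antisym)
  show "?L \<le> ?R"
  proof (rule SUP_least)
    fix Q assume Q: "Q \<in> kantorovich_ambiguity_set S (c ` {1..V}) (dirac_mixture V c a) r"
    let ?E = "measure_pmf.expectation Q g" and ?D = "\<Sum>i=1..V. a i * g (c i)"
    have le: "ereal ((1 - l) * ?E + l * ?D) \<le> ?R" if l: "0 < l" "l < 1" for l
    proof -
      obtain q w where "(q, w) \<in> lp_feasible V c a r"
        and "(\<Sum>i=1..V. q i * g (c i)) = (1 - l) * ?E + l * ?D"
        using ambiguity_imp_lp_feasible[OF a r l Q, where thesis = thesis] that by blast
      then show ?thesis by (intro SUP_upper2[of "(q, w)"]) auto
    qed
    \<comment> \<open>The upper bound \<open>?R\<close> does not depend on \<open>l\<close>, so it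
      passes to the limit from the right.\<close>
    have "((\<lambda>l. (1 - l) * ?E + l * ?D) \<longlongrightarrow> (1 - 0) * ?E + 0 * ?D) (at_right 0)"
      by (intro tendsto_intros)
    then have "((\<lambda>l. ereal ((1 - l) * ?E + l * ?D)) \<longlongrightarrow> ereal ?E) (at_right 0)" by simp
    moreover have "eventually (\<lambda>l::real. ereal ((1 - l) * ?E + l * ?D) \<le> ?R) (at_right 0)"
      unfolding eventually_at_right_field using le by (intro exI[of _ 1]) auto
    ultimately show "ereal ?E \<le> ?R"
      by (rule tendsto_upperbound) simp
  qed
  show "?R \<le> ?L"
  proof (rule SUP_least, clarify)
    fix q w assume "(q, w) \<in> lp_feasible V c a r"
    then obtain Q where "Q \<in> kantorovich_ambiguity_set S (c ` {1..V}) (dirac_mixture V c a) r"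
      and "measure_pmf.expectation Q g = (\<Sum>i=1..V. q i * g (c i))"
      using lp_feasible_imp_ambiguity[of V c S a q w r thesis] c a that by blast
    then show "ereal (\<Sum>i=1..V. q i * g (c i)) \<le> ?L" by (intro SUP_upper2[of Q]) auto
  qed
qed

section \<open>Empirical frequencies and assembly of the result\<close>

text \<open>The cells are disjoint and cover \<open>S\<close>, so every sample point is counted
  exactly once.\<close>

lemma sum_cell_freq:
  assumes C: "voronoi_tessellation S V c C" and smp: "\<forall>n\<in>{1..N}. smp n \<in> S" and N: "N \<ge> 1"
  shows "(\<Sum>j=1..V. cell_freq N smp C j) = 1"
proof -
  let ?B = "\<lambda>j. {n \<in> {1..N}. smp n \<in> C j}"
  have "(\<Sum>j=1..V. card (?B j)) = card (\<Union>j\<in>{1..V}. ?B j)"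
    using C by (subst card_UN_disjoint)
      (auto simp: voronoi_tessellation_def disjoint_family_on_def)
  also have "(\<Union>j\<in>{1..V}. ?B j) = {1..N}"
    using C smp by (auto simp: voronoi_tessellation_def)
  finally have "(\<Sum>j=1..V. real (card (?B j))) = real N"
    by (simp flip: of_nat_sum)
  then show ?thesis
    using N by (simp add: cell_freq_def sum_divide_distrib[symmetric])
qed

theorem proposition4p1:
  fixes M :: "'m measure" and X :: "'m \<Rightarrow> real"
    and K :: nat and x p :: "nat \<Rightarrow> real"
    and \<Omega> :: "'n measure" and st :: "'n \<Rightarrow> 's::euclidean_space" and S :: "'s set"
    and \<sigma> :: "real \<Rightarrow> 's \<Rightarrow> real"
    and V N :: nat and shat :: "nat \<Rightarrow> 's" and C :: "nat \<Rightarrow> 's set" and smp :: "nat \<Rightarrow> 's"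
    and r :: real
  assumes "prob_space M" and "X \<in> borel_measurable M"
    and "\<forall>k\<in>{1..K}. measure M {\<omega> \<in> space M. X \<omega> = x k} = p k"
    and "(\<Sum>k=1..K. p k) = 1"
    and "strict_mono_on {1..K} x"
    and "prob_space \<Omega>" and "st \<in> borel_measurable \<Omega>"
    and "S = dist_support (distr \<Omega> borel st)"
    and "\<forall>s\<in>S. risk_spectrum (\<lambda>t. \<sigma> t s)"
    and "\<forall>j\<in>{1..V}. shat j \<in> S"
    and "voronoi_tessellation S V shat C"
    and "N \<ge> 1" and "\<forall>n\<in>{1..N}. smp n \<in> S"
    and "r > 0"
  shows "(SUP Q \<in> kantorovich_ambiguity_set S (shat ` {1..V})
                    (dirac_mixture V shat (cell_freq N smp C)) r.
            ereal (measure_pmf.expectation Q (\<lambda>s. spectral_risk M X (\<lambda>t. \<sigma> t s))))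
       = (SUP (q, w) \<in> lp_feasible V shat (cell_freq N smp C) r.
            ereal (\<Sum>i=1..V. q i * (\<Sum>k=1..K. x k * spectral_weight (\<lambda>t. \<sigma> t (shat i)) p k)))"
proof -
  interpret discrete_loss M X K x p
    unfolding discrete_loss_def discrete_loss_axioms_def using assms(1-5) by simp
  let ?a = "cell_freq N smp C"
  \<comment> \<open>The duality-free equality of suprema is applied with the spectral risk as a
    function of the state.\<close>
  have "(SUP Q \<in> kantorovich_ambiguity_set S (shat ` {1..V}) (dirac_mixture V shat ?a) r.
            ereal (measure_pmf.expectation Q (\<lambda>s. spectral_risk M X (\<lambda>t. \<sigma> t s))))
       = (SUP (q, w) \<in> lp_feasible V shat ?a r.
            ereal (\<Sum>i=1..V. q i * spectral_risk M X (\<lambda>t. \<sigma> t (shat i))))"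
    using assms(10-14) sum_cell_freq
    by (intro SUP_ambiguity_eq_SUP_lp) (auto simp: cell_freq_def)
  \<comment> \<open>The linear program evaluates the risk at the centres; these lie in
    \<open>S\<close>, so the spectrum there is integrable and the finite formula applies.\<close>
  moreover have "spectral_risk M X (\<lambda>t. \<sigma> t (shat i))
      = (\<Sum>k=1..K. x k * spectral_weight (\<lambda>t. \<sigma> t (shat i)) p k)" if "i \<in> {1..V}" for i
    using assms(9,10) that by (intro spectral_risk_eq) (auto simp: risk_spectrum_def)
  ultimately show ?thesis by simp
qed

end
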